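(* Let $m\ge2$ be an integer and let $g\colon[0,1]\to\mathbb{R}$ be a continuous function. Then the convex envelope $u_g^*$ of $g$ on $\mathbb{T}_m$ satisfies $$\lim_{x\to\pi}u_g^*(x)=g(\psi(\pi))\qquad\text{for every }\pi\in\partial\mathbb{T}_m.$$
   Context: Tree. For an integer $m\ge2$, $\mathbb{T}_m$ is the infinite $m$-branching tree whose vertices are the root $\emptyset$ and all finite sequences $(a_1,\dots,a_k)$, $k\ge1$, with $a_i\in\{0,\dots,m-1\}$. The level of $x=(a_1,\dots,a_k)$ is $|x|=k$, and $|\emptyset|=0$. The successors of $x$ are $\mathcal{S}(x)=\{(x,i): i\in\{0,\dots,m-1\}\}$. If $x\ne\emptyset$, $\hat{x}$ denotes its unique immediate predecessor; vertices are adjacent exactly to their successors and predecessor. Boundary. A branch is an infinite sequence of vertices, each followed by one of its successors, identified with $\pi=(a_1,a_2,\dots)$, $a_k\in\{0,\dots,m-1\}$; $\partial\mathbb{T}_m$ is the set of all branches. Define $\psi(\pi)=\sum_{k=1}^{\infty}a_k m^{-k}\in[0,1]$. For $u\colon\mathbb{T}_m\to\mathbb{R}$ and $\pi=(a_1,a_2,\dots)$, $\lim_{x\to\pi}u(x)$ and $\limsup_{x\to\pi}u(x)$ are the limit and limsup of $u(x_k)$ as $k\to\infty$, where $x_k=(a_1,\dots,a_k)$. Distance. The edge $(\hat{x},x)$ has length $m^{-|x|}$. For vertices $x,y$, $[x,y]$ is the unique minimal path (path with all vertices different) from $x$ to $y$, and $d(x,y)$ is the sum of the lengths of its edges. Convexity.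 $u\colon\mathbb{T}_m\to\mathbb{R}$ is convex if for all $x\ne y$ in $\mathbb{T}_m$ and all $z\in[x,y]$, $u(z)\le\frac{d(y,z)}{d(x,y)}u(x)+\frac{d(x,z)}{d(x,y)}u(y)$. Convex envelope. For $g\colon[0,1]\to\mathbb{R}$, let $\mathcal{C}(g)$ be the set of convex functions $u\colon\mathbb{T}_m\to\mathbb{R}$ with $\limsup_{x\to\pi}u(x)\le g(\psi(\pi))$ for all $\pi\in\partial\mathbb{T}_m$, and $u_g^*(x)=\sup\{u(x):u\in\mathcal{C}(g)\}$. *)

theory Defs
  imports Complex_Main "HOL-Library.Extended_Real" "HOL-Library.Sublist"
begin

(* The vertex (a_1, ..., a_k) is the list [a_1, ..., a_k]; the root is [] and the level is
   the length, so successors are obtained by appending at the end. *)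

definition tree_vertices :: "nat \<Rightarrow> nat list set" where
  "tree_vertices m = {x. set x \<subseteq> {..<m}}"

definition successors :: "nat \<Rightarrow> nat list \<Rightarrow> nat list set" where
  "successors m x = {x @ [i] | i. i < m}"

definition adjacent :: "nat \<Rightarrow> nat list \<Rightarrow> nat list \<Rightarrow> bool" where
  "adjacent m x y \<longleftrightarrow> y \<in> successors m x \<or> x \<in> successors m y"

definition is_minimal_path :: "nat \<Rightarrow> nat list \<Rightarrow> nat list \<Rightarrow> nat list list \<Rightarrow> bool" where
  "is_minimal_path m x y p \<longleftrightarrow>
     p \<noteq> [] \<and> hd p = x \<and> last p = y \<and> set p \<subseteq> tree_vertices m \<and>
     successively (adjacent m) p \<and> distinct p"

lemma adjacent_prefix_iff:
  assumes "adjacent m v w" "v \<noteq> x" "w \<noteq> x"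
  shows "prefix x v \<longleftrightarrow> prefix x w"
  using assms by (auto simp: adjacent_def successors_def)

lemma successively_prefix_iff:
  assumes "successively (adjacent m) q" "x \<notin> set q" "v \<in> set q"
  shows "prefix x v \<longleftrightarrow> prefix x (hd q)"
  using assms
proof (induction q arbitrary: v)
  case (Cons a q)
  show ?case
  proof (cases "v = a \<or> q = []")
    case False
    then have v: "v \<in> set q" and q: "q \<noteq> []" using Cons.prems by auto
    have "prefix x v \<longleftrightarrow> prefix x (hd q)"
      using Cons.IH[OF _ _ v] Cons.prems(1,2) q by (simp add: successively_Cons)
    moreover have "prefix x a \<longleftrightarrow> prefix x (hd q)"
      using Cons.prems(1,2) q hd_in_set[OF q]
      by (intro adjacent_prefix_iff[of m]) (auto simp: successively_Cons)
    ultimately show ?thesis by simp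
  qed (use Cons.prems(3) in auto)
qed simp

lemma adjacent_not_prefix:
  assumes "adjacent m (x @ [i]) v" "\<not> prefix (x @ [i]) v"
  shows "v = x"
  using assms by (auto simp: adjacent_def successors_def)

lemma is_minimal_path_rev:
  "is_minimal_path m x y (rev p) \<longleftrightarrow> is_minimal_path m y x p"
proof -
  have "(\<lambda>v w. adjacent m w v) = adjacent m"
    by (auto simp: adjacent_def fun_eq_iff)
  then have "successively (\<lambda>v w. adjacent m w v) p \<longleftrightarrow> successively (adjacent m) p"
    by (rule arg_cong)
  then show ?thesis
    by (auto simp: is_minimal_path_def hd_rev last_rev)
qed

lemma is_minimal_path_step:
  assumes x: "x @ [i] \<in> tree_vertices m" and np: "\<not> prefix (x @ [i]) y"
  shows "is_minimal_path m (x @ [i]) y p \<longleftrightarrow> (\<exists>q. p = (x @ [i]) # q \<and> is_minimal_path m x y q)"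
    (is "?L \<longleftrightarrow> ?R")
proof
  assume L: ?L
  then obtain q where p: "p = (x @ [i]) # q"
    by (cases p) (auto simp: is_minimal_path_def)
  have q: "q \<noteq> []" using L np p by (auto simp: is_minimal_path_def)
  have "prefix (x @ [i]) y \<longleftrightarrow> prefix (x @ [i]) (hd q)"
    using L p q by (intro successively_prefix_iff[of m])
      (auto simp: is_minimal_path_def successively_Cons)
  then have "hd q = x"
    using L p q np by (intro adjacent_not_prefix[of m x i])
      (auto simp: is_minimal_path_def successively_Cons)
  then show ?R using L p q by (auto simp: is_minimal_path_def successively_Cons)
next
  assume ?R
  then obtain q where p: "p = (x @ [i]) # q" and q: "is_minimal_path m x y q" by blast
  have "x @ [i] \<notin> set q"
  proof
    assume "x @ [i] \<in> set q"
    then obtain q1 q2 where q12: "q = q1 @ (x @ [i]) # q2" by (meson split_list)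
    have "q1 \<noteq> []" using q q12 by (auto simp: is_minimal_path_def)
    moreover have "hd q1 = x" using q q12 calculation by (simp add: is_minimal_path_def)
    ultimately have q1: "q1 \<noteq> []" "hd q1 = x" by blast+
    have q2: "q2 \<noteq> []" using q q12 np by (auto simp: is_minimal_path_def)
    have "prefix (x @ [i]) y \<longleftrightarrow> prefix (x @ [i]) (hd q2)"
      using q q12 q2 by (intro successively_prefix_iff[of m])
        (auto simp: is_minimal_path_def successively_append_iff successively_Cons)
    then have "hd q2 = x"
      using q q12 q2 np by (intro adjacent_not_prefix[of m x i])
        (auto simp: is_minimal_path_def successively_append_iff successively_Cons)
    then have "x \<in> set q1 \<inter> set q2" using q1 q2 hd_in_set[of q1] hd_in_set[of q2] by simp
    moreover have "set q1 \<inter> set q2 = {}"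
      using q q12 by (simp add: is_minimal_path_def)
    ultimately show False by simp
  qed
  moreover have "adjacent m (x @ [i]) x"
    using x by (auto simp: adjacent_def successors_def tree_vertices_def)
  ultimately show ?L
    using p q x by (auto simp: is_minimal_path_def successively_Cons)
qed

lemma ex1_minimal_path:
  assumes "x \<in> tree_vertices m" "y \<in> tree_vertices m"
  shows "\<exists>!p. is_minimal_path m x y p"
  using assms
proof (induction "length x + length y" arbitrary: x y rule: less_induct)
  case less
  have step: "\<exists>!p. is_minimal_path m v w p"
    if "v \<in> tree_vertices m" "w \<in> tree_vertices m" "\<not> prefix v w"
      "length v + length w = length x + length y" for v w
  proof -
    have "v \<noteq> []" using that(3) by auto
    then obtain v' i where v: "v = v' @ [i]" by (cases v rule: rev_cases) auto
    have "\<exists>!q. is_minimal_path m v' w q"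
    proof (rule less.hyps)
      show "length v' + length w < length x + length y" using that(4) v by simp
      show "v' \<in> tree_vertices m" using that(1) v by (simp add: tree_vertices_def)
    qed (rule that(2))
    then obtain q where q: "\<And>p. is_minimal_path m v' w p \<longleftrightarrow> p = q" by metis
    have "is_minimal_path m v w p \<longleftrightarrow> p = v # q" for p
      using is_minimal_path_step[of v' i m w p] that(1,3) v q by simp
    then show ?thesis by metis
  qed
  consider "x = y" | "\<not> prefix x y" | "\<not> prefix y x"
    by (metis prefix_order.antisym)
  then show ?case
  proof cases
    case 1
    have "is_minimal_path m x x p \<longleftrightarrow> p = [x]" for p
      using less.prems by (cases p) (auto simp: is_minimal_path_def split: if_splits)
    then show ?thesis using 1 by metis
  next
    case 2
    then show ?thesis using step[of x y] less.prems by simp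
  next
    case 3
    then have "\<exists>!p. is_minimal_path m y x p" using step[of y x] less.prems by simp
    then show ?thesis by (metis is_minimal_path_rev rev_rev_ident)
  qed
qed

definition minimal_path :: "nat \<Rightarrow> nat list \<Rightarrow> nat list \<Rightarrow> nat list list" where
  "minimal_path m x y = (THE p. is_minimal_path m x y p)"

(* The edge joining a vertex x to its predecessor has length m^(-|x|), and x is the endpoint
   with the larger level. *)
definition edge_length :: "nat \<Rightarrow> nat list \<Rightarrow> nat list \<Rightarrow> real" where
  "edge_length m x y = 1 / real m ^ max (length x) (length y)"

definition tree_dist :: "nat \<Rightarrow> nat list \<Rightarrow> nat list \<Rightarrow> real" where
  "tree_dist m x y =
     (let p = minimal_path m x y in \<Sum>i<length p - 1. edge_length m (p ! i) (p ! Suc i))"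

(* Functions on the tree are functions on all lists; only their values on the vertices of the
   tree matter. *)
definition tree_convex :: "nat \<Rightarrow> (nat list \<Rightarrow> real) \<Rightarrow> bool" where
  "tree_convex m u \<longleftrightarrow>
     (\<forall>x\<in>tree_vertices m. \<forall>y\<in>tree_vertices m. x \<noteq> y \<longrightarrow>
       (\<forall>z\<in>set (minimal_path m x y).
          u z \<le> tree_dist m y z / tree_dist m x y * u x + tree_dist m x z / tree_dist m x y * u y))"

(* The branch (a_1, a_2, ...) is represented by the sequence b with b k = a_(k+1). *)
definition branches :: "nat \<Rightarrow> (nat \<Rightarrow> nat) set" where
  "branches m = {b. \<forall>k. b k < m}"

definition branch_vertex :: "(nat \<Rightarrow> nat) \<Rightarrow> nat \<Rightarrow> nat list" where
  "branch_vertex b k = map b [0..<k]"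

definition psi :: "nat \<Rightarrow> (nat \<Rightarrow> nat) \<Rightarrow> real" where
  "psi m b = (\<Sum>k. real (b k) / real m ^ Suc k)"

definition convex_minorants :: "nat \<Rightarrow> (real \<Rightarrow> real) \<Rightarrow> (nat list \<Rightarrow> real) set" where
  "convex_minorants m g =
     {u. tree_convex m u \<and>
         (\<forall>b\<in>branches m. limsup (\<lambda>k. ereal (u (branch_vertex b k))) \<le> ereal (g (psi m b)))}"

(* If m \<ge> 2 and g is bounded on [0,1], the set below is nonempty (constants) and bounded above
   by sup g (apply convexity along paths through x whose ends descend along two different
   branches), so the supremum is the genuine one. *)
definition convex_envelope :: "nat \<Rightarrow> (real \<Rightarrow> real) \<Rightarrow> nat list \<Rightarrow> real" where
  "convex_envelope m g x = (SUP u\<in>convex_minorants m g. u x)"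

end

theory Submission imports Defs begin

text \<open>
  The limit is squeezed between two bounds on the cone below a vertex \<open>x\<close> of the branch, that is, on
  the set of branches through \<open>x\<close>. The boundary points of such branches lie within
  \<open>m ^ - |x|\<close> of each other (\<open>psi_dist_le\<close>), so by continuity \<open>g\<close> is almost constant on the
  cone once \<open>|x|\<close> is large (\<open>boundary_oscillation_small\<close>).

  Upper bound (\<open>convex_minorant_le\<close>). Leave \<open>x\<close> through two different children and go down
  both sides to the same level. The two vertices reached are at equal distance from \<open>x\<close>, and \<open>x\<close>
  lies on the path between them, so a convex \<open>u\<close> satisfies \<open>u x \<le> (u y + u z) / 2\<close>. If \<open>u\<close> is
  a minorant, the right-hand side is asymptotically at most the supremum of \<open>g\<close> over the cone.
  The bound does not depend on \<open>u\<close>, so it passes to the envelope.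

  Lower bound (\<open>minorant_on_cone\<close>). One explicit minorant is enough. Take a function that is
  constant off the cone of \<open>v\<close> and grows linearly with the distance from \<open>v\<close> inside the cone.
  It is convex: the slopes that occur along a path are, in this order, \<open>- C\<close> (going up inside the
  cone), \<open>0\<close> (outside) and \<open>C\<close> (going down inside the cone). Since the distance from \<open>v\<close> to the
  boundary is finite and the same along all branches, the function has one and the same limit on the
  whole cone. The constant is chosen to be a lower bound of \<open>g\<close>, and \<open>C\<close> so that the limit
  is a value slightly below \<open>g\<close> on the cone.

  Both bounds rest on explicit descriptions of the path between \<open>x\<close> and \<open>y\<close>: it goes up from
  \<open>x\<close> to the longest common prefix of \<open>x\<close> and \<open>y\<close> and then down to \<open>y\<close>
  (\<open>set_minimal_path\<close>, \<open>tree_dist_eq\<close>).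
\<close>

section \<open>Paths and distances in the tree\<close>

lemma minimal_path_is_minimal_path:
  assumes "x \<in> tree_vertices m" "y \<in> tree_vertices m"
  shows "is_minimal_path m x y (minimal_path m x y)"
  unfolding minimal_path_def by (rule theI'[OF ex1_minimal_path[OF assms]])

lemma minimal_path_eqI:
  assumes "x \<in> tree_vertices m" "y \<in> tree_vertices m" "is_minimal_path m x y p"
  shows "minimal_path m x y = p"
  using ex1_minimal_path[OF assms(1,2)] minimal_path_is_minimal_path[OF assms(1,2)] assms(3)
  by blast

lemma minimal_path_refl:
  assumes "x \<in> tree_vertices m"
  shows "minimal_path m x x = [x]"
  by (rule minimal_path_eqI) (use assms in \<open>auto simp: is_minimal_path_def\<close>)

lemma minimal_path_commute:
  assumes "x \<in> tree_vertices m" "y \<in> tree_vertices m"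
  shows "minimal_path m y x = rev (minimal_path m x y)"
  by (rule minimal_path_eqI)
    (use assms minimal_path_is_minimal_path[OF assms] in \<open>auto simp: is_minimal_path_rev\<close>)

lemma minimal_path_step:
  assumes "x @ [i] \<in> tree_vertices m" "y \<in> tree_vertices m" "\<not> prefix (x @ [i]) y"
  shows "minimal_path m (x @ [i]) y = (x @ [i]) # minimal_path m x y"
proof (rule minimal_path_eqI)
  have "x \<in> tree_vertices m" using assms(1) by (simp add: tree_vertices_def)
  then show "is_minimal_path m (x @ [i]) y ((x @ [i]) # minimal_path m x y)"
    using is_minimal_path_step[OF assms(1,3)] minimal_path_is_minimal_path assms(2) by blast
qed (use assms in auto)

lemma tree_dist_refl:
  assumes "x \<in> tree_vertices m"
  shows "tree_dist m x x = 0"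
  using assms by (simp add: tree_dist_def minimal_path_refl)

lemma edge_length_commute: "edge_length m x y = edge_length m y x"
  by (simp add: edge_length_def max.commute)

lemma tree_dist_commute:
  assumes "x \<in> tree_vertices m" "y \<in> tree_vertices m"
  shows "tree_dist m y x = tree_dist m x y"
proof -
  define p where "p = minimal_path m x y"
  have "(\<Sum>i<length p - 1. edge_length m (rev p ! i) (rev p ! Suc i))
      = (\<Sum>i<length p - 1. edge_length m (p ! i) (p ! Suc i))"
  proof (rule sum.reindex_bij_witness[of _ "\<lambda>i. length p - 2 - i" "\<lambda>i. length p - 2 - i"])
    fix i assume "i \<in> {..<length p - 1}"
    then have i: "i < length p - 1" by simp
    have "rev p ! i = p ! Suc (length p - 2 - i)" "rev p ! Suc i = p ! (length p - 2 - i)"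
      using i by (auto simp: rev_nth intro!: arg_cong[where f = "nth p"])
    then show "edge_length m (p ! (length p - 2 - i)) (p ! Suc (length p - 2 - i))
        = edge_length m (rev p ! i) (rev p ! Suc i)"
      by (simp add: edge_length_commute)
  qed auto
  then show ?thesis
    by (simp add: tree_dist_def minimal_path_commute[OF assms] p_def Let_def)
qed

lemma tree_dist_step:
  assumes "x @ [i] \<in> tree_vertices m" "y \<in> tree_vertices m" "\<not> prefix (x @ [i]) y"
  shows "tree_dist m (x @ [i]) y = 1 / real m ^ Suc (length x) + tree_dist m x y"
proof -
  define p where "p = minimal_path m x y"
  have "x \<in> tree_vertices m" using assms(1) by (simp add: tree_vertices_def)
  from minimal_path_is_minimal_path[OF this assms(2)]
  have p: "p \<noteq> []" "hd p = x" by (auto simp: p_def is_minimal_path_def)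
  then have len: "length p = Suc (length p - 1)" and p0: "p ! 0 = x" by (auto simp: hd_conv_nth)
  have "tree_dist m (x @ [i]) y
      = (\<Sum>j<length p. edge_length m (((x @ [i]) # p) ! j) (((x @ [i]) # p) ! Suc j))"
    unfolding tree_dist_def minimal_path_step[OF assms] p_def[symmetric] Let_def by simp
  also have "\<dots> = edge_length m (x @ [i]) (p ! 0)
      + (\<Sum>j<length p - 1. edge_length m (p ! j) (p ! Suc j))"
    by (subst len, subst sum.lessThan_Suc_shift) simp
  finally show ?thesis by (simp add: p0 edge_length_def tree_dist_def p_def[symmetric] Let_def)
qed

text \<open>
  Induction along a path: a pair of distinct vertices has a member that is not a prefix of the other,
  and the path between the two begins (or, after a swap, ends) with the edge from that member to its
  predecessor.
\<close>
lemma tree_pair_induct [consumes 2, case_names refl commute step]: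
  assumes "x \<in> tree_vertices m" "y \<in> tree_vertices m"
    and refl: "\<And>x. x \<in> tree_vertices m \<Longrightarrow> P x x"
    and commute: "\<And>x y. x \<in> tree_vertices m \<Longrightarrow> y \<in> tree_vertices m \<Longrightarrow> P x y \<Longrightarrow> P y x"
    and step: "\<And>x i y. x @ [i] \<in> tree_vertices m \<Longrightarrow> x \<in> tree_vertices m \<Longrightarrow> y \<in> tree_vertices m
      \<Longrightarrow> \<not> prefix (x @ [i]) y \<Longrightarrow> P x y \<Longrightarrow> P (x @ [i]) y"
  shows "P x y"
  using assms(1,2)
proof (induction "length x + length y" arbitrary: x y rule: less_induct)
  case less
  have descend: "P v w"
    if vw: "v \<in> tree_vertices m" "w \<in> tree_vertices m" "\<not> prefix v w"
      "length v + length w = length x + length y" for v w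
  proof -
    obtain v' i where v: "v = v' @ [i]" using vw(3) by (cases v rule: rev_cases) auto
    have v': "v' \<in> tree_vertices m" using vw(1) v by (simp add: tree_vertices_def)
    have "P v' w" by (rule less.hyps) (use vw v v' in auto)
    then show ?thesis using step[of v' i w] vw v v' by simp
  qed
  consider "x = y" | "\<not> prefix x y" | "\<not> prefix y x"
    by (metis prefix_order.antisym)
  then show ?case
    by cases (use refl commute[of y x] descend[of x y] descend[of y x] less.prems in auto)
qed

lemma longest_common_prefix_commute:
  "longest_common_prefix xs ys = longest_common_prefix ys xs"
  by (induction xs ys rule: longest_common_prefix.induct) auto

lemma longest_common_prefix_eqI:
  assumes "prefix w x" "prefix w y" "\<And>v. prefix v x \<Longrightarrow> prefix v y \<Longrightarrow> prefix v w"
  shows "longest_common_prefix x y = w"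
  by (intro prefix_order.antisym assms longest_common_prefix_max_prefix
      longest_common_prefix_prefix1 longest_common_prefix_prefix2)

lemma longest_common_prefix_absorb1:
  "prefix x y \<Longrightarrow> longest_common_prefix x y = x"
  by (rule longest_common_prefix_eqI) auto

lemma longest_common_prefix_snoc:
  assumes "\<not> prefix (x @ [i]) y"
  shows "longest_common_prefix (x @ [i]) y = longest_common_prefix x y"
  using assms
proof (induction x y rule: longest_common_prefix.induct)
  case ("2_1" y)
  then show ?case by (cases y) auto
qed auto

definition root_dist :: "nat \<Rightarrow> nat \<Rightarrow> real" where
  "root_dist m n = (\<Sum>j<n. 1 / real m ^ Suc j)"

lemma root_dist_mono: "k \<le> n \<Longrightarrow> root_dist m k \<le> root_dist m n"
  unfolding root_dist_def by (rule sum_mono2) auto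

lemma root_dist_prefix: "prefix x y \<Longrightarrow> root_dist m (length x) \<le> root_dist m (length y)"
  by (intro root_dist_mono prefix_length_le)

text \<open>The boundary is at finite distance from the root, and at the same distance along all branches.\<close>
lemma root_dist_tendsto:
  assumes "m \<ge> 2"
  shows "root_dist m \<longlonglongrightarrow> 1 / (real m - 1)"
proof -
  have "(\<lambda>j. 1 / real m * (1 / real m) ^ j) sums (1 / real m * (1 / (1 - 1 / real m)))"
    by (intro sums_mult geometric_sums) (use assms in auto)
  moreover have "1 / real m * (1 / (1 - 1 / real m)) = 1 / (real m - 1)"
    using assms by (simp add: field_simps)
  ultimately show ?thesis
    by (simp add: sums_def root_dist_def[abs_def] power_divide)
qed

lemma tree_dist_eq:
  assumes "x \<in> tree_vertices m" "y \<in> tree_vertices m"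
  shows "tree_dist m x y = root_dist m (length x) + root_dist m (length y)
    - 2 * root_dist m (length (longest_common_prefix x y))"
  using assms
proof (induction rule: tree_pair_induct)
  case (refl x)
  then show ?case by (simp add: tree_dist_refl longest_common_prefix_absorb1)
next
  case (commute x y)
  then show ?case by (simp add: tree_dist_commute longest_common_prefix_commute[of y x])
next
  case (step x i y)
  then show ?case
    by (simp add: tree_dist_step longest_common_prefix_snoc root_dist_def)
qed

lemma tree_dist_prefix:
  assumes "y \<in> tree_vertices m" "x \<in> tree_vertices m" "prefix x y"
  shows "tree_dist m x y = root_dist m (length y) - root_dist m (length x)"
  using tree_dist_eq[OF assms(2,1)] longest_common_prefix_absorb1[OF assms(3)] by simp

lemma set_minimal_path:
  assumes "x \<in> tree_vertices m" "y \<in> tree_vertices m"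
  shows "set (minimal_path m x y)
    = {z. prefix (longest_common_prefix x y) z \<and> (prefix z x \<or> prefix z y)}"
  using assms
proof (induction rule: tree_pair_induct)
  case (refl x)
  then show ?case by (auto simp: minimal_path_refl longest_common_prefix_absorb1)
next
  case (commute x y)
  then show ?case
    by (auto simp: minimal_path_commute[OF commute(1,2)] longest_common_prefix_commute[of y x])
next
  case (step x i y)
  define w v where "w = longest_common_prefix x y" and "v = x @ [i]"
  have w: "longest_common_prefix v y = w"
    unfolding v_def w_def by (rule longest_common_prefix_snoc[OF step(4)])
  then have wv: "prefix w v" using longest_common_prefix_prefix1 by metis
  have pv: "prefix z v \<longleftrightarrow> z = v \<or> prefix z x" for z by (simp add: v_def)
  have "set (minimal_path m v y) = insert v {z. prefix w z \<and> (prefix z x \<or> prefix z y)}"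
    unfolding v_def minimal_path_step[OF step(1,3,4)] w_def step.IH[symmetric] by simp
  also have "\<dots> = {z. prefix w z \<and> (prefix z v \<or> prefix z y)}"
  proof (rule set_eqI)
    fix z
    show "z \<in> insert v {z. prefix w z \<and> (prefix z x \<or> prefix z y)}
        \<longleftrightarrow> z \<in> {z. prefix w z \<and> (prefix z v \<or> prefix z y)}"
      using wv by (cases "z = v") (simp_all add: pv)
  qed
  finally show ?case unfolding w[symmetric] v_def .
qed

section \<open>Bump functions\<close>

text \<open>
  Inside the cone of \<open>v\<close> the difference of the two distances from the root is the distance from
  \<open>v\<close> to \<open>x\<close>.
\<close>
definition bump :: "nat \<Rightarrow> real \<Rightarrow> real \<Rightarrow> nat list \<Rightarrow> nat list \<Rightarrow> real" where
  "bump m a C v x =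
     a + (if prefix v x then C * (root_dist m (length x) - root_dist m (length v)) else 0)"

lemma bump_ge:
  assumes "C \<ge> 0"
  shows "bump m a C v x \<ge> a"
  using assms root_dist_prefix[of v x m] by (auto simp: bump_def)

text \<open>
  Convexity at the points \<open>z\<close> of the part of the path that ascends from \<open>x\<close>; those above \<open>y\<close>
  follow by swapping \<open>x\<close> and \<open>y\<close>. The inequality is multiplied by the distance of \<open>x\<close> and \<open>y\<close>, so that in
  each case the difference of its two sides is an explicit nonnegative expression in the
  distances from the root.
\<close>
lemma bump_convex_on_ascent:
  assumes x: "x \<in> tree_vertices m" and y: "y \<in> tree_vertices m" and C: "C \<ge> 0"
    and wz: "prefix (longest_common_prefix x y) z" and zx: "prefix z x"
  shows "tree_dist m x y * bump m a C v z
    \<le> tree_dist m y z * bump m a C v x + tree_dist m x z * bump m a C v y"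
proof -
  define w where "w = longest_common_prefix x y"
  have z: "z \<in> tree_vertices m"
    using x zx by (auto simp: tree_vertices_def dest: set_mono_prefix)
  have wy: "prefix w y" by (simp add: w_def longest_common_prefix_prefix2)
  let ?r = "\<lambda>x. root_dist m (length x)"
  have lcp: "longest_common_prefix y z = w"
  proof (rule longest_common_prefix_eqI[OF wy])
    show "prefix w z" using wz by (simp add: w_def)
    show "prefix v w" if "prefix v y" "prefix v z" for v
      unfolding w_def using that zx
      by (intro longest_common_prefix_max_prefix) (auto intro: prefix_order.trans)
  qed
  have dxy: "tree_dist m x y = ?r x + ?r y - 2 * ?r w"
    using tree_dist_eq[OF x y] by (simp add: w_def)
  have dyz: "tree_dist m y z = ?r y + ?r z - 2 * ?r w"
    using tree_dist_eq[OF y z] lcp by simp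
  have dxz: "tree_dist m x z = ?r x - ?r z"
    using tree_dist_prefix[OF x z zx] tree_dist_commute[OF x z] by simp
  have rwz: "?r w \<le> ?r z" and rzx: "?r z \<le> ?r x" and rwy: "?r w \<le> ?r y"
    using root_dist_prefix wz zx wy by (auto simp: w_def)
  have total: "tree_dist m x y = tree_dist m y z + tree_dist m x z"
    by (simp add: dxy dyz dxz)
  have nonneg: "tree_dist m y z \<ge> 0" "tree_dist m x z \<ge> 0"
    using rwz rzx rwy by (auto simp: dyz dxz)
  consider "\<not> prefix v z" | "prefix v z" "prefix v y" | "prefix v z" "\<not> prefix v y" by blast
  then show ?thesis
  proof cases
    case 1
    then have "bump m a C v z = a" by (simp add: bump_def)
    moreover have "tree_dist m y z * a \<le> tree_dist m y z * bump m a C v x"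
      "tree_dist m x z * a \<le> tree_dist m x z * bump m a C v y"
      using nonneg bump_ge[OF C] by (auto intro!: mult_left_mono)
    ultimately show ?thesis by (simp add: total ring_distribs)
  next
    case 2
    (* Here the whole path lies in the cone of v, where the bump is affine in the distance from
       the root; the only gain is the turn of the path at w. *)
    then have vx: "prefix v x" using zx by (meson prefix_order.trans)
    have "0 \<le> 2 * C * ((?r x - ?r z) * (?r y - ?r w))"
      using C rzx rwy by simp
    also have "\<dots> = tree_dist m y z * bump m a C v x + tree_dist m x z * bump m a C v y
        - tree_dist m x y * bump m a C v z"
      using 2 vx by (simp add: bump_def dxy dyz dxz algebra_simps)
    finally show ?thesis by simp
  next
    case 3
    (* Here v lies on the part of the path between w and z. *)
    then have vx: "prefix v x" using zx by (meson prefix_order.trans)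
    have "prefix w v"
      using 3 wz wy unfolding w_def by (meson prefix_order.trans prefix_same_cases)
    then have rwv: "?r w \<le> ?r v" by (rule root_dist_prefix)
    have "0 \<le> C * ((?r x - ?r z) * ((?r y - ?r w) + (?r v - ?r w)))"
      using C rzx rwy rwv by simp
    also have "\<dots> = tree_dist m y z * bump m a C v x + tree_dist m x z * bump m a C v y
        - tree_dist m x y * bump m a C v z"
      using 3 vx by (simp add: bump_def dxy dyz dxz algebra_simps)
    finally show ?thesis by simp
  qed
qed

lemma tree_dist_pos:
  assumes "m \<ge> 2" and x: "x \<in> tree_vertices m" and y: "y \<in> tree_vertices m" and "x \<noteq> y"
  shows "tree_dist m x y > 0"
proof -
  have strict: "root_dist m (length w) < root_dist m (length v)" if "strict_prefix w v" for w v
  proof -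
    have "length w < length v" using that by (rule prefix_length_less)
    then have "root_dist m (Suc (length w)) \<le> root_dist m (length v)"
      by (intro root_dist_mono) simp
    moreover have "root_dist m (length w) < root_dist m (Suc (length w))"
      using assms(1) by (simp add: root_dist_def)
    ultimately show ?thesis by simp
  qed
  define w where "w = longest_common_prefix x y"
  have w: "prefix w x" "prefix w y"
    by (simp_all add: w_def longest_common_prefix_prefix1 longest_common_prefix_prefix2)
  then have "strict_prefix w x \<or> strict_prefix w y" using assms(4) by (auto simp: strict_prefix_def)
  then show ?thesis
    using tree_dist_eq[OF x y] strict[of w x] strict[of w y] root_dist_prefix[OF w(1), of m]
      root_dist_prefix[OF w(2), of m]
    by (auto simp: w_def[symmetric])
qed

lemma tree_convex_bump:
  assumes "m \<ge> 2" "C \<ge> 0"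
  shows "tree_convex m (bump m a C v)"
  unfolding tree_convex_def
proof (intro ballI impI)
  fix x y z
  assume x: "x \<in> tree_vertices m" and y: "y \<in> tree_vertices m" and "x \<noteq> y"
    and z: "z \<in> set (minimal_path m x y)"
  note pos = tree_dist_pos[OF assms(1) x y \<open>x \<noteq> y\<close>]
  have "prefix (longest_common_prefix x y) z" "prefix z x \<or> prefix z y"
    using z by (auto simp: set_minimal_path[OF x y])
  then have "tree_dist m x y * bump m a C v z
      \<le> tree_dist m y z * bump m a C v x + tree_dist m x z * bump m a C v y"
    using bump_convex_on_ascent[OF x y assms(2), of z a v]
      bump_convex_on_ascent[OF y x assms(2), of z a v]
    by (auto simp: longest_common_prefix_commute[of y x] tree_dist_commute[OF x y])
  then show "bump m a C v z \<le> tree_dist m y z / tree_dist m x y * bump m a C v x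
      + tree_dist m x z / tree_dist m x y * bump m a C v y"
    using pos by (simp add: field_simps)
qed

section \<open>Branches and their boundary points\<close>

lemma branch_vertex_in_tree: "b \<in> branches m \<Longrightarrow> branch_vertex b k \<in> tree_vertices m"
  by (auto simp: branches_def branch_vertex_def tree_vertices_def)

lemma length_branch_vertex [simp]: "length (branch_vertex b k) = k"
  by (simp add: branch_vertex_def)

lemma take_branch_vertex: "k \<le> n \<Longrightarrow> take k (branch_vertex b n) = branch_vertex b k"
  by (simp add: branch_vertex_def take_map)

lemma prefix_branch_vertex_iff:
  "prefix v (branch_vertex b n) \<longleftrightarrow> length v \<le> n \<and> branch_vertex b (length v) = v"
proof
  assume v: "prefix v (branch_vertex b n)"
  then have "length v \<le> n" using prefix_length_le by fastforce
  moreover have "take (length v) (branch_vertex b n) = v" using v by (auto simp: prefix_def)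
  ultimately show "length v \<le> n \<and> branch_vertex b (length v) = v"
    by (simp add: take_branch_vertex)
next
  assume "length v \<le> n \<and> branch_vertex b (length v) = v"
  then show "prefix v (branch_vertex b n)" by (metis take_branch_vertex take_is_prefix)
qed

lemma psi_term_bound:
  assumes "m \<ge> 2" "b \<in> branches m"
  shows "real (b k) / real m ^ Suc k \<le> (real m - 1) * (1 / real m ^ Suc k)"
proof -
  have "b k < m" using assms(2) by (auto simp: branches_def)
  then have "real (b k) \<le> real m - 1" by linarith
  then show ?thesis using assms(1) by (simp add: divide_right_mono)
qed

lemma max_digits_sums:
  assumes "m \<ge> 2"
  shows "(\<lambda>j. (real m - 1) * (1 / real m ^ Suc j)) sums 1"
proof -
  have "(\<lambda>j. 1 / real m ^ Suc j) sums (1 / (real m - 1))"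
    using root_dist_tendsto[OF assms] by (simp add: sums_def root_dist_def[abs_def])
  from sums_mult[OF this, of "real m - 1"] show ?thesis using assms by simp
qed

lemma psi_summable:
  assumes "m \<ge> 2" "b \<in> branches m"
  shows "summable (\<lambda>k. real (b k) / real m ^ Suc k)"
  by (rule summable_comparison_test'[OF sums_summable[OF max_digits_sums[OF assms(1)]], of 0])
    (use psi_term_bound[OF assms] in simp)

lemma psi_in_unit_interval:
  assumes "m \<ge> 2" "b \<in> branches m"
  shows "psi m b \<in> {0..1}"
proof -
  have "psi m b \<le> (\<Sum>j. (real m - 1) * (1 / real m ^ Suc j))"
    unfolding psi_def
    by (intro suminf_le psi_term_bound psi_summable assms sums_summable[OF max_digits_sums])
  also have "\<dots> = 1" using max_digits_sums[OF assms(1)] by (rule sums_unique[symmetric])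
  finally have "psi m b \<le> 1" .
  moreover have "0 \<le> psi m b"
    unfolding psi_def by (intro suminf_nonneg psi_summable assms) simp
  ultimately show ?thesis by simp
qed

lemma psi_shift:
  assumes "m \<ge> 2" "b \<in> branches m"
  shows "psi m b = (\<Sum>k<n. real (b k) / real m ^ Suc k) + psi m (\<lambda>k. b (k + n)) / real m ^ n"
proof -
  have b': "(\<lambda>k. b (k + n)) \<in> branches m" using assms(2) by (simp add: branches_def)
  have "(\<Sum>k. real (b (k + n)) / real m ^ Suc (k + n))
      = (\<Sum>k. real (b (k + n)) / real m ^ Suc k / real m ^ n)"
    by (intro suminf_cong) (simp add: power_add)
  also have "\<dots> = psi m (\<lambda>k. b (k + n)) / real m ^ n"
    unfolding psi_def by (rule suminf_divide[OF psi_summable[OF assms(1) b']])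
  finally show ?thesis
    using suminf_split_initial_segment[OF psi_summable[OF assms], of n] by (simp add: psi_def)
qed

lemma psi_dist_le:
  assumes "m \<ge> 2" "b \<in> branches m" "c \<in> branches m" "branch_vertex b n = branch_vertex c n"
  shows "\<bar>psi m b - psi m c\<bar> \<le> 1 / real m ^ n"
proof -
  have eq: "b k = c k" if "k < n" for k
    using assms(4) that by (auto simp: branch_vertex_def)
  have tails: "psi m (\<lambda>k. b (k + n)) \<in> {0..1}" "psi m (\<lambda>k. c (k + n)) \<in> {0..1}"
    using assms by (auto intro!: psi_in_unit_interval simp: branches_def simp del: atLeastAtMost_iff)
  have "psi m b - psi m c = (psi m (\<lambda>k. b (k + n)) - psi m (\<lambda>k. c (k + n))) / real m ^ n"
    using psi_shift[OF assms(1,2), of n] psi_shift[OF assms(1,3), of n] eq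
    by (simp add: diff_divide_distrib)
  then show ?thesis
    using tails by (auto simp: abs_div divide_right_mono)
qed

lemma boundary_oscillation_small:
  fixes g :: "real \<Rightarrow> real"
  assumes "m \<ge> 2" "continuous_on {0..1} g" "b \<in> branches m" "e > 0"
  obtains n where "\<And>c. c \<in> branches m \<Longrightarrow> branch_vertex c n = branch_vertex b n
    \<Longrightarrow> \<bar>g (psi m c) - g (psi m b)\<bar> < e"
proof -
  have "(g \<longlongrightarrow> g (psi m b)) (at (psi m b) within {0..1})"
    using assms(2) psi_in_unit_interval[OF assms(1,3)] by (auto simp: continuous_on_def)
  from tendstoD[OF this assms(4)] obtain d where "d > 0" and
    "\<forall>t\<in>{0..1}. t \<noteq> psi m b \<and> dist t (psi m b) < d \<longrightarrow> dist (g t) (g (psi m b)) < e"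
    unfolding eventually_at by auto
  then have d: "d > 0"
    "t \<in> {0..1} \<Longrightarrow> \<bar>t - psi m b\<bar> < d \<Longrightarrow> \<bar>g t - g (psi m b)\<bar> < e" for t
    using assms(4) by (cases "t = psi m b"; force simp: dist_real_def)+
  obtain n where "(1 / real m) ^ n < d"
    using real_arch_pow_inv[OF d(1), of "1 / real m"] assms(1) by auto
  then have "1 / real m ^ n < d" by (simp add: power_divide)
  then have "\<bar>g (psi m c) - g (psi m b)\<bar> < e"
    if "c \<in> branches m" "branch_vertex c n = branch_vertex b n" for c
    using psi_dist_le[OF assms(1) that(1) assms(3) that(2)] psi_in_unit_interval[OF assms(1) that(1)]
    by (intro d(2)) auto
  then show ?thesis by (rule that)
qed

section \<open>Bounds for the convex envelope\<close>

lemma bump_tendsto: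
  assumes "m \<ge> 2" "branch_vertex b (length v) = v"
  shows "(\<lambda>k. bump m a C v (branch_vertex b k))
    \<longlonglongrightarrow> a + C * (1 / (real m - 1) - root_dist m (length v))"
proof (rule Lim_transform_eventually)
  show "(\<lambda>k. a + C * (root_dist m k - root_dist m (length v)))
      \<longlonglongrightarrow> a + C * (1 / (real m - 1) - root_dist m (length v))"
    by (intro tendsto_intros root_dist_tendsto assms)
  show "\<forall>\<^sub>F k in sequentially. a + C * (root_dist m k - root_dist m (length v))
      = bump m a C v (branch_vertex b k)"
    using eventually_ge_at_top[of "length v"]
    by eventually_elim (use assms(2) in \<open>simp add: bump_def prefix_branch_vertex_iff\<close>)
qed

text \<open>
  The lower barrier: dividing by the distance \<open>L\<close> from \<open>v\<close> to the boundary makes the bump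
  reach exactly the prescribed height \<open>h\<close> on every branch through \<open>v\<close>.
\<close>
lemma minorant_on_cone:
  assumes m: "m \<ge> 2" and a: "\<And>c. c \<in> branches m \<Longrightarrow> a \<le> g (psi m c)"
    and h: "\<And>c. c \<in> branches m \<Longrightarrow> branch_vertex c (length v) = v \<Longrightarrow> h \<le> g (psi m c)"
    and ah: "a \<le> h"
  obtains u where "u \<in> convex_minorants m g"
    "\<And>c. branch_vertex c (length v) = v \<Longrightarrow> (\<lambda>k. u (branch_vertex c k)) \<longlonglongrightarrow> h"
proof -
  define L where "L = 1 / (real m - 1) - root_dist m (length v)"
  have "root_dist m (Suc (length v)) \<le> 1 / (real m - 1)"
    by (rule incseq_le[OF _ root_dist_tendsto[OF m]]) (simp add: incseq_def root_dist_mono)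
  moreover have "root_dist m (length v) < root_dist m (Suc (length v))"
    using m by (simp add: root_dist_def)
  ultimately have L: "L > 0" by (simp add: L_def)
  define u where "u = bump m a ((h - a) / L) v"
  have lim: "(\<lambda>k. u (branch_vertex c k)) \<longlonglongrightarrow> h" if "branch_vertex c (length v) = v" for c
    using bump_tendsto[OF m that, of a "(h - a) / L"] L by (simp add: u_def L_def[symmetric])
  have "limsup (\<lambda>k. ereal (u (branch_vertex c k))) \<le> ereal (g (psi m c))"
    if c: "c \<in> branches m" for c
  proof (cases "branch_vertex c (length v) = v")
    case True
    then have "limsup (\<lambda>k. ereal (u (branch_vertex c k))) = ereal h"
      by (intro lim_imp_Limsup) (use lim in auto)
    then show ?thesis using h[OF c True] by simp
  next
    case False
    then show ?thesis
      using a[OF c] by (simp add: u_def bump_def prefix_branch_vertex_iff Limsup_const)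
  qed
  moreover have "tree_convex m u"
    unfolding u_def using m L ah by (intro tree_convex_bump) auto
  ultimately have "u \<in> convex_minorants m g" by (simp add: convex_minorants_def)
  then show ?thesis using lim by (rule that)
qed

text \<open>
  A maximum principle on cones: \<open>x\<close> is the midpoint of two vertices that descend
  from it through different children, and these can be taken arbitrarily close to the boundary.
\<close>
lemma convex_minorant_le:
  assumes m: "m \<ge> 2" and u: "u \<in> convex_minorants m g" and x: "x \<in> tree_vertices m"
    and h: "\<And>c. c \<in> branches m \<Longrightarrow> branch_vertex c (length x) = x \<Longrightarrow> g (psi m c) \<le> h"
  shows "u x \<le> h"
proof (rule field_le_epsilon)
  fix e :: real assume e: "e > 0"
  define n where "n = length x"
  (* c i continues x by the digit i for ever; c 0 and c 1 separate at x. *)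
  define c where "c i k = (if k < n then x ! k else i)" for i k :: nat
  have c: "c i \<in> branches m" if "i < m" for i
    using x that by (auto simp: branches_def c_def n_def tree_vertices_def dest: nth_mem)
  have cx: "branch_vertex (c i) n = x" for i
    by (rule nth_equalityI) (auto simp: branch_vertex_def c_def n_def)
  have ev: "\<forall>\<^sub>F k in sequentially. u (branch_vertex (c i) k) < h + e" if "i < m" for i
  proof -
    have "limsup (\<lambda>k. ereal (u (branch_vertex (c i) k))) \<le> ereal (g (psi m (c i)))"
      using u c[OF that] by (simp add: convex_minorants_def)
    also have "\<dots> < ereal (h + e)"
      using h[OF c[OF that] cx[unfolded n_def]] e by simp
    finally show ?thesis
      by (auto dest: Limsup_lessD)
  qed
  have "\<forall>\<^sub>F k in sequentially. u (branch_vertex (c 0) k) < h + e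
      \<and> u (branch_vertex (c 1) k) < h + e \<and> k > n"
    using m by (intro eventually_conj ev eventually_gt_at_top) auto
  then obtain k where k: "u (branch_vertex (c 0) k) < h + e" "u (branch_vertex (c 1) k) < h + e" "k > n"
    by (auto dest: eventually_happens)
  define y where "y i = branch_vertex (c i) k" for i
  have y: "y 0 \<in> tree_vertices m" "y 1 \<in> tree_vertices m"
    using c m by (auto simp: y_def intro!: branch_vertex_in_tree)
  have xy: "prefix x (y i)" for i
    using k(3) cx by (simp add: y_def prefix_branch_vertex_iff n_def[symmetric])
  have yn: "y i ! n = i" for i using k(3) by (simp add: y_def branch_vertex_def c_def)
  then have ne: "y 0 \<noteq> y 1" by (metis zero_neq_one)
  have lcp: "longest_common_prefix (y 0) (y 1) = x"
  proof -
    let ?w = "longest_common_prefix (y 0) (y 1)"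
    have w: "prefix ?w (y 0)" "prefix ?w (y 1)"
      by (simp_all add: longest_common_prefix_prefix1 longest_common_prefix_prefix2)
    have "prefix x ?w" using xy by (simp add: longest_common_prefix_max_prefix)
    moreover have "length ?w \<le> n"
    proof (rule ccontr)
      assume "\<not> length ?w \<le> n"
      then have "?w ! n = y 0 ! n" "?w ! n = y 1 ! n"
        using w by (metis prefix_def nth_append not_le)+
      then show False by (simp add: yn)
    qed
    ultimately show ?thesis by (auto simp: n_def prefix_def)
  qed
  have len: "length (y i) = k" for i by (simp add: y_def)
  define D where "D = root_dist m k - root_dist m n"
  have dist: "tree_dist m (y 0) (y 1) = 2 * D"
    using tree_dist_eq[OF y] lcp by (simp add: D_def len n_def)
  have dx: "tree_dist m (y i) x = D" if "i < m" for i
    using tree_dist_prefix[OF _ x xy, of i] tree_dist_commute[OF x, of "y i"] c[OF that]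
    by (simp add: y_def branch_vertex_in_tree D_def n_def)
  have pos: "D > 0" using tree_dist_pos[OF m y ne] dist by simp
  have "x \<in> set (minimal_path m (y 0) (y 1))"
    using set_minimal_path[OF y] lcp xy by simp
  then have "u x \<le> tree_dist m (y 1) x / tree_dist m (y 0) (y 1) * u (y 0)
      + tree_dist m (y 0) x / tree_dist m (y 0) (y 1) * u (y 1)"
    using u y ne by (auto simp: convex_minorants_def tree_convex_def)
  also have "\<dots> = (u (y 0) + u (y 1)) / 2"
    unfolding dist using dx[of 0] dx[of 1] m pos by (simp add: field_simps)
  also have "\<dots> \<le> h + e" using k by (simp add: y_def)
  finally show "u x \<le> h + e" .
qed

theorem theorem3p3:
  fixes m :: nat and g :: "real \<Rightarrow> real"
  assumes "m \<ge> 2" and "continuous_on {0..1} g"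
  shows "\<forall>b\<in>branches m. (\<lambda>k. convex_envelope m g (branch_vertex b k)) \<longlonglongrightarrow> g (psi m b)"
proof
  fix b assume b: "b \<in> branches m"
  obtain lo hi where lo: "\<And>t. t \<in> {0..1} \<Longrightarrow> lo \<le> g t" and hi: "\<And>t. t \<in> {0..1} \<Longrightarrow> g t \<le> hi"
    using continuous_attains_inf[OF compact_Icc _ assms(2)]
      continuous_attains_sup[OF compact_Icc _ assms(2)] by fastforce
  have bdd: "bdd_above ((\<lambda>u. u x) ` convex_minorants m g)" if "x \<in> tree_vertices m" for x
    using convex_minorant_le[OF assms(1) _ that, of _ g hi] hi psi_in_unit_interval[OF assms(1)]
    by (intro bdd_aboveI[of _ hi]) auto
  show "(\<lambda>k. convex_envelope m g (branch_vertex b k)) \<longlonglongrightarrow> g (psi m b)"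
  proof (rule LIMSEQ_I)
    fix e :: real assume e: "e > 0"
    then obtain n where n: "\<And>c. c \<in> branches m \<Longrightarrow> branch_vertex c n = branch_vertex b n
        \<Longrightarrow> \<bar>g (psi m c) - g (psi m b)\<bar> < e / 2"
      using boundary_oscillation_small[OF assms b, of "e / 2"] by auto
    obtain u where u: "u \<in> convex_minorants m g"
      and lim: "\<And>c. branch_vertex c n = branch_vertex b n
        \<Longrightarrow> (\<lambda>k. u (branch_vertex c k)) \<longlonglongrightarrow> g (psi m b) - e / 2"
    proof (rule minorant_on_cone[OF assms(1), of "min lo (g (psi m b) - e / 2)" g
          "branch_vertex b n" "g (psi m b) - e / 2"])
      show "min lo (g (psi m b) - e / 2) \<le> g (psi m c)" if "c \<in> branches m" for c
        using lo[OF psi_in_unit_interval[OF assms(1) that]] by simp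
      show "g (psi m b) - e / 2 \<le> g (psi m c)"
        if "c \<in> branches m" "branch_vertex c (length (branch_vertex b n)) = branch_vertex b n" for c
        using n[OF that(1) that(2)[unfolded length_branch_vertex]] by linarith
    qed auto
    have "\<forall>\<^sub>F k in sequentially. g (psi m b) - e < u (branch_vertex b k)"
      using e by (intro order_tendstoD(1)[OF lim]) auto
    then obtain n' where n': "\<And>k. k \<ge> n' \<Longrightarrow> g (psi m b) - e < u (branch_vertex b k)"
      by (auto simp: eventually_sequentially)
    show "\<exists>no. \<forall>k\<ge>no. norm (convex_envelope m g (branch_vertex b k) - g (psi m b)) < e"
    proof (intro exI allI impI)
      fix k assume k: "k \<ge> max n n'"
      note x = branch_vertex_in_tree[OF b, of k]
      have "u (branch_vertex b k) \<le> convex_envelope m g (branch_vertex b k)"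
        unfolding convex_envelope_def by (rule cSUP_upper[OF u bdd[OF x]])
      then have lower: "g (psi m b) - e < convex_envelope m g (branch_vertex b k)"
        using n'[of k] k by simp
      have "convex_envelope m g (branch_vertex b k) \<le> g (psi m b) + e / 2"
        unfolding convex_envelope_def
      proof (rule cSUP_least)
        fix w assume w: "w \<in> convex_minorants m g"
        show "w (branch_vertex b k) \<le> g (psi m b) + e / 2"
        proof (rule convex_minorant_le[OF assms(1) w x])
          fix c assume c: "c \<in> branches m"
            and "branch_vertex c (length (branch_vertex b k)) = branch_vertex b k"
          then have "branch_vertex c n = branch_vertex b n"
            using k by (metis length_branch_vertex max.bounded_iff take_branch_vertex)
          from n[OF c this] show "g (psi m c) \<le> g (psi m b) + e / 2" by linarith
        qed
      qed (use u in auto)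
      with lower e show "norm (convex_envelope m g (branch_vertex b k) - g (psi m b)) < e"
        by (simp add: abs_less_iff)
    qed
  qed
qed

end
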